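(* Let $S^{(N)}=[S_0^{(N)},S_1^{(N)},\dots,S_{m-1}^{(N)}]$, $S_{\mathrm{in}}^{(N)}=[S_{0,\mathrm{in}}^{(N)},S_{1,\mathrm{in}}^{(N)},\dots,S_{m-1,\mathrm{in}}^{(N)}]$ and $S_{\mathrm{out}}^{(N)}=[S_{0,\mathrm{out}}^{(N)},S_{1,\mathrm{out}}^{(N)},\dots,S_{m-1,\mathrm{out}}^{(N)}]$, and let $\tilde S^{(N)}\in\mathbb{C}^{n\times\ell m}$ be the matrix obtained by numerically computing $S^{(N)}$ (an arbitrary matrix, possibly affected by rounding errors). Then $$S_{\mathrm{in}}^{(N)}\in\left\langle S^{(N)},\left|S_{\mathrm{out}}^{(N)}\right|\right\rangle\subset\left\langle\tilde S^{(N)},\left|S_{\mathrm{out}}^{(N)}\right|+\left|\tilde S^{(N)}-S^{(N)}\right|\right\rangle,$$ where $|\cdot|$ is the entrywise modulus and $\langle C,R\rangle$ denotes the interval matrix with center $C$ and entrywise nonnegative radius $R$, i.e. the set of all complex matrices $Z$ of the same size with $|Z-C|\le R$ entrywise.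
   Context: Setting. $A=A^{\mathsf H}\in\mathbb{C}^{n\times n}$, $B=B^{\mathsf H}\in\mathbb{C}^{n\times n}$ is positive semidefinite, $r=\mathrm{rank}\,B$, and the pencil $zB-A$ is regular. Fix a nonsingular $X=[\boldsymbol{x}_1,\dots,\boldsymbol{x}_n]\in\mathbb{C}^{n\times n}$ giving the Weierstrass canonical form $X^{\mathsf H}(zB-A)X=z\,(\mathrm{I}_r\oplus \mathrm{O})-\Lambda$ with $\Lambda=\mathrm{diag}(\lambda_1,\dots,\lambda_r)\oplus \mathrm{I}_{n-r}$, where $\oplus$ is the direct sum of matrices. The $\lambda_i\in\mathbb{R}$ ($i=1,\dots,r$) are the eigenvalues, with multiplicity, of $A\boldsymbol{x}=\lambda B\boldsymbol{x}$, with corresponding $B$-orthonormal eigenvectors $\boldsymbol{x}_i$. Let $\Omega=[a,b]\subset\mathbb{R}$ ($a<b$), $\gamma=(a+b)/2$, $\rho=(b-a)/2$. Exactly $t$ eigenvalues, $\lambda_1,\dots,\lambda_t$, lie in $\Omega$, neither $a$ nor $b$ is an eigenvalue, and $\lambda_{t+1},\dots,\lambda_r$ lie outside $\Omega$. Let $N,\ell,m$ be positive integers and $V\in\mathbb{C}^{n\times\ell}$. Put $$d_i^{(N)}=\frac{1}{1-\left(\frac{\lambda_i-\gamma}{\rho}\right)^N}\ (i=1,\dots,t),\qquad d_i^{(N)}=\frac{-\left(\frac{\rho}{\lambda_i-\gamma}\right)^N}{1-\left(\frac{\rho}{\lambda_i-\gamma}\right)^N}\ (i=t+1,\dots,r).$$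 For $k=0,\dots,m-1$ let $$M_{k,\mathrm{in}}^{(N)}=\sum_{i=1}^t(\lambda_i-\gamma)^kd_i^{(N)}\boldsymbol{x}_i\boldsymbol{x}_i^{\mathsf H},\quad M_{k,\mathrm{out}}^{(N)}=\sum_{i=t+1}^r(\lambda_i-\gamma)^kd_i^{(N)}\boldsymbol{x}_i\boldsymbol{x}_i^{\mathsf H},\quad M_k^{(N)}=\sum_{i=1}^r(\lambda_i-\gamma)^kd_i^{(N)}\boldsymbol{x}_i\boldsymbol{x}_i^{\mathsf H},$$ and $S_{k}^{(N)}=M_{k}^{(N)}BV$, $S_{k,\mathrm{in}}^{(N)}=M_{k,\mathrm{in}}^{(N)}BV$, $S_{k,\mathrm{out}}^{(N)}=M_{k,\mathrm{out}}^{(N)}BV$. *)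

theory Defs
  imports
    "Jordan_Normal_Form.DL_Rank"
    "Jordan_Normal_Form.Schur_Decomposition"
begin

definition hermitian_mat :: "complex mat \<Rightarrow> bool" where
  "hermitian_mat A \<longleftrightarrow> square_mat A \<and> mat_adjoint A = A"

text \<open>For a Hermitian \<open>B\<close> the quadratic form is real, so nothing is lost by taking \<open>Re\<close>.\<close>

definition positive_semidefinite :: "complex mat \<Rightarrow> bool" where
  "positive_semidefinite B \<longleftrightarrow> hermitian_mat B \<and>
     (\<forall>v \<in> carrier_vec (dim_row B). 0 \<le> Re ((B *\<^sub>v v) \<bullet>c v))"

definition regular_pencil :: "complex mat \<Rightarrow> complex mat \<Rightarrow> bool" where
  "regular_pencil A B \<longleftrightarrow> (\<exists>z. det (z \<cdot>\<^sub>m B - A) \<noteq> 0)"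

definition pencil_eigenvalue :: "complex mat \<Rightarrow> complex mat \<Rightarrow> complex \<Rightarrow> bool" where
  "pencil_eigenvalue A B \<mu> \<longleftrightarrow>
     (\<exists>x \<in> carrier_vec (dim_row A). x \<noteq> 0\<^sub>v (dim_row A) \<and> A *\<^sub>v x = \<mu> \<cdot>\<^sub>v (B *\<^sub>v x))"

definition direct_sum_mat :: "complex mat \<Rightarrow> complex mat \<Rightarrow> complex mat" where
  "direct_sum_mat P Q = diag_block_mat [P, Q]"

text \<open>The finite eigenvalues \<open>\<lambda>\<^sub>1, \<dots>, \<lambda>\<^sub>r\<close> are \<open>lam 0, \<dots>, lam (r - 1)\<close>, and the
  eigenvectors \<open>x\<^sub>1, \<dots>, x\<^sub>n\<close> are the columns \<open>col X 0, \<dots>, col X (n - 1)\<close>.\<close>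

definition weierstrass_form ::
  "nat \<Rightarrow> nat \<Rightarrow> complex mat \<Rightarrow> complex mat \<Rightarrow> complex mat \<Rightarrow> (nat \<Rightarrow> real) \<Rightarrow> bool" where
  "weierstrass_form n r A B X lam \<longleftrightarrow>
     (\<forall>z. mat_adjoint X * (z \<cdot>\<^sub>m B - A) * X =
        z \<cdot>\<^sub>m direct_sum_mat (1\<^sub>m r) (0\<^sub>m (n - r) (n - r))
        - direct_sum_mat (mat_diag r (\<lambda>i. of_real (lam i))) (1\<^sub>m (n - r)))"

definition filter_coeff ::
  "nat \<Rightarrow> nat \<Rightarrow> real \<Rightarrow> real \<Rightarrow> (nat \<Rightarrow> real) \<Rightarrow> nat \<Rightarrow> real" where
  "filter_coeff N t \<gamma> \<rho> lam i =
     (if i < t then 1 / (1 - ((lam i - \<gamma>) / \<rho>) ^ N)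
      else - ((\<rho> / (lam i - \<gamma>)) ^ N) / (1 - (\<rho> / (lam i - \<gamma>)) ^ N))"

text \<open>The rank-one matrix \<open>x x\<^sup>H\<close>.\<close>

definition self_outer :: "complex vec \<Rightarrow> complex mat" where
  "self_outer x = mat_of_cols (dim_vec x) [x] * mat_adjoint (mat_of_cols (dim_vec x) [x])"

text \<open>The moment matrix of order \<open>k\<close> whose sum is restricted to the indices in \<open>I\<close>.  With
  zero-based indices, \<open>I = {0..<r}\<close> gives \<open>M\<^sub>k\<close>, \<open>I = {0..<t}\<close> gives its inner part and
  \<open>I = {t..<r}\<close> its outer part.\<close>

definition moment_mat ::
  "nat \<Rightarrow> nat \<Rightarrow> nat \<Rightarrow> real \<Rightarrow> real \<Rightarrow> (nat \<Rightarrow> real) \<Rightarrow> complex mat \<Rightarrow> nat set \<Rightarrow> nat \<Rightarrow> complex mat"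
  where
  "moment_mat n N t \<gamma> \<rho> lam X I k =
     finsum (module_mat TYPE(complex) n n)
       (\<lambda>i. of_real ((lam i - \<gamma>) ^ k * filter_coeff N t \<gamma> \<rho> lam i) \<cdot>\<^sub>m self_outer (col X i)) I"

text \<open>The block row \<open>[F 0, F 1, \<dots>, F (m - 1)]\<close>, where each \<open>F k\<close> has \<open>n\<close> rows.\<close>

definition block_row :: "nat \<Rightarrow> nat \<Rightarrow> (nat \<Rightarrow> complex mat) \<Rightarrow> complex mat" where
  "block_row n m F = mat_of_cols n (concat (map (\<lambda>k. cols (F k)) [0..<m]))"

abbreviation mat_modulus :: "complex mat \<Rightarrow> real mat" where
  "mat_modulus Z \<equiv> map_mat cmod Z"

text \<open>The order on matrices is entrywise and requires equal dimensions.  The carrier condition on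
  \<open>Z\<close> is needed because \<open>Z - C\<close> takes its dimensions from \<open>C\<close> alone.\<close>

definition interval_mat :: "complex mat \<Rightarrow> real mat \<Rightarrow> complex mat set" where
  "interval_mat C R =
     {Z \<in> carrier_mat (dim_row C) (dim_col C). mat_modulus (Z - C) \<le> R}"

end

theory Submission
  imports Defs
begin

text \<open>
  The index set of the full moment sum is the disjoint union of the indices inside and outside
  \<open>\<Omega>\<close> (\<open>moment_mat_Un_disjoint\<close>), and both multiplication by \<open>B V\<close> and the formation of a block
  row (\<open>block_row_add\<close>) are additive.  Hence \<open>S = S\<^sub>i\<^sub>n + S\<^sub>o\<^sub>u\<^sub>t\<close>, so that \<open>S\<^sub>i\<^sub>n\<close> differs from the
  center \<open>S\<close> by exactly \<open>S\<^sub>o\<^sub>u\<^sub>t\<close> in modulus (\<open>summand_in_interval_mat\<close>).  The inclusion is a fact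
  about arbitrary interval matrices: when the center is moved, the triangle inequality pays for
  the move by enlarging the radius by the entrywise distance of the centers
  (\<open>interval_mat_recenter\<close>).
\<close>

lemma self_outer_carrier: "self_outer x \<in> carrier_mat (dim_vec x) (dim_vec x)"
  unfolding self_outer_def mat_adjoint_def by (intro carrier_matI) simp_all

lemma moment_summand_carrier:
  assumes "X \<in> carrier_mat n n"
  shows "c \<cdot>\<^sub>m self_outer (col X i) \<in> carrier_mat n n"
  using self_outer_carrier[of "col X i"] assms by simp

lemma moment_mat_carrier:
  assumes "X \<in> carrier_mat n n"
  shows "moment_mat n N t \<gamma> \<rho> lam X I k \<in> carrier_mat n n"
proof -
  interpret abelian_group "module_mat TYPE(complex) n n" by (rule abelian_group_mat)
  show ?thesis
    unfolding moment_mat_def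
    by (rule finsum_closed[unfolded module_mat_simps]) (intro Pi_I moment_summand_carrier assms)
qed

lemma moment_mat_Un_disjoint:
  assumes "X \<in> carrier_mat n n" "finite I" "finite J" "I \<inter> J = {}"
  shows "moment_mat n N t \<gamma> \<rho> lam X (I \<union> J) k
    = moment_mat n N t \<gamma> \<rho> lam X I k + moment_mat n N t \<gamma> \<rho> lam X J k"
proof -
  interpret abelian_group "module_mat TYPE(complex) n n" by (rule abelian_group_mat)
  show ?thesis
    unfolding moment_mat_def
    using finsum_Un_disjoint[OF assms(2-4)] moment_summand_carrier[OF assms(1)]
    by (simp add: module_mat_simps)
qed

lemma cols_add:
  assumes "P \<in> carrier_mat n l" "Q \<in> carrier_mat n l"
  shows "cols (P + Q) = map2 (+) (cols P) (cols Q)"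
  using assms by (intro nth_equalityI) auto

lemma length_concat_cols:
  assumes "\<And>k. k < m \<Longrightarrow> F k \<in> carrier_mat n l"
  shows "length (concat (map (\<lambda>k. cols (F k)) [0..<m])) = l * m"
  using assms by (induction m) auto

lemma block_row_carrier:
  assumes "\<And>k. k < m \<Longrightarrow> F k \<in> carrier_mat n l"
  shows "block_row n m F \<in> carrier_mat n (l * m)"
  unfolding block_row_def using length_concat_cols[OF assms, of m]
  by (intro carrier_matI) auto

lemma concat_cols_add:
  assumes "\<And>k. k < m \<Longrightarrow> F k \<in> carrier_mat n l" "\<And>k. k < m \<Longrightarrow> G k \<in> carrier_mat n l"
  shows "concat (map (\<lambda>k. cols (F k + G k)) [0..<m])
    = map2 (+) (concat (map (\<lambda>k. cols (F k)) [0..<m])) (concat (map (\<lambda>k. cols (G k)) [0..<m]))"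
  using assms
proof (induction m)
  case (Suc m)
  have "cols (F m + G m) = map2 (+) (cols (F m)) (cols (G m))"
    using Suc.prems by (intro cols_add[of _ n l]) auto
  then show ?case
    using Suc length_concat_cols[of m F n l] length_concat_cols[of m G n l] by simp
qed simp

lemma concat_cols_carrier:
  assumes "\<And>k. k < m \<Longrightarrow> F k \<in> carrier_mat n l"
  shows "set (concat (map (\<lambda>k. cols (F k)) [0..<m])) \<subseteq> carrier_vec n"
proof -
  have "set (cols (F k)) \<subseteq> carrier_vec n" if "k < m" for k
    using cols_dim[of "F k"] assms[OF that] by simp
  then show ?thesis by (auto simp: subset_eq)
qed

text \<open>A block row is assembled by concatenating lists of columns, and the blocks of both
  summands have the same width, so corresponding columns meet in the same position.\<close>

lemma block_row_add:
  assumes "\<And>k. k < m \<Longrightarrow> F k \<in> carrier_mat n l" "\<And>k. k < m \<Longrightarrow> G k \<in> carrier_mat n l"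
  shows "block_row n m (\<lambda>k. F k + G k) = block_row n m F + block_row n m G"
proof -
  let ?f = "concat (map (\<lambda>k. cols (F k)) [0..<m])"
  let ?g = "concat (map (\<lambda>k. cols (G k)) [0..<m])"
  have len: "length ?f = l * m" "length ?g = l * m"
    using length_concat_cols assms by blast+
  have dim: "dim_vec (?g ! j) = n" if "j < l * m" for j
  proof -
    have "?g ! j \<in> set ?g"
      using that len(2) by (intro nth_mem) simp
    moreover have "set ?g \<subseteq> carrier_vec n"
      using assms(2) by (rule concat_cols_carrier)
    ultimately show ?thesis
      using carrier_vecD by blast
  qed
  have "mat_of_cols n (map2 (+) ?f ?g) = mat_of_cols n ?f + mat_of_cols n ?g"
    using len dim by (intro eq_matI) (simp_all del: concat.simps length_concat add: mat_of_cols_index)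
  then show ?thesis
    unfolding block_row_def using concat_cols_add[OF assms] by simp
qed

lemma summand_in_interval_mat:
  assumes "P \<in> carrier_mat n l" "Q \<in> carrier_mat n l"
  shows "P \<in> interval_mat (P + Q) (mat_modulus Q)"
  using assms by (auto simp: interval_mat_def less_eq_mat_def)

lemma interval_mat_recenter:
  assumes "C \<in> carrier_mat n l" "C' \<in> carrier_mat n l"
  shows "interval_mat C R \<subseteq> interval_mat C' (R + mat_modulus (C' - C))"
proof
  fix Z assume Z: "Z \<in> interval_mat C R"
  have carrier: "Z \<in> carrier_mat n l" "R \<in> carrier_mat n l"
    using Z assms by (auto simp: interval_mat_def less_eq_mat_def)
  have "cmod (Z $$ (i, j) - C' $$ (i, j)) \<le> R $$ (i, j) + cmod (C' $$ (i, j) - C $$ (i, j))"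
    if "i < n" "j < l" for i j
  proof -
    have "cmod (Z $$ (i, j) - C $$ (i, j)) \<le> R $$ (i, j)"
      using Z that assms carrier by (auto simp: interval_mat_def less_eq_mat_def)
    then show ?thesis
      using norm_triangle_ineq4[of "Z $$ (i, j) - C $$ (i, j)" "C' $$ (i, j) - C $$ (i, j)"]
      by simp
  qed
  then show "Z \<in> interval_mat C' (R + mat_modulus (C' - C))"
    using assms carrier by (auto simp: interval_mat_def less_eq_mat_def)
qed

theorem theorem2p6:
  fixes A B X V S S_in S_out S_num :: "complex mat"
    and lam :: "nat \<Rightarrow> real"
    and a b \<gamma> \<rho> :: real
    and n r t N l m :: nat
  assumes A: "A \<in> carrier_mat n n" "hermitian_mat A"
    and B: "B \<in> carrier_mat n n" "positive_semidefinite B"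
    and r: "r = vec_space.rank n B"
    and regular: "regular_pencil A B"
    and X: "X \<in> carrier_mat n n" "invertible_mat X"
    and weierstrass: "weierstrass_form n r A B X lam"
    and \<Omega>: "a < b" "\<gamma> = (a + b) / 2" "\<rho> = (b - a) / 2"
    and t: "t \<le> r"
    and inside: "\<And>i. i < t \<Longrightarrow> lam i \<in> {a..b}"
    and outside: "\<And>i. t \<le> i \<Longrightarrow> i < r \<Longrightarrow> lam i \<notin> {a..b}"
    and endpoints: "\<not> pencil_eigenvalue A B (of_real a)" "\<not> pencil_eigenvalue A B (of_real b)"
    and pos: "N > 0" "l > 0" "m > 0"
    and V: "V \<in> carrier_mat n l"
    and S: "S = block_row n m (\<lambda>k. moment_mat n N t \<gamma> \<rho> lam X {0..<r} k * B * V)"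
    and S_in: "S_in = block_row n m (\<lambda>k. moment_mat n N t \<gamma> \<rho> lam X {0..<t} k * B * V)"
    and S_out: "S_out = block_row n m (\<lambda>k. moment_mat n N t \<gamma> \<rho> lam X {t..<r} k * B * V)"
    and S_num: "S_num \<in> carrier_mat n (l * m)"
  shows "S_in \<in> interval_mat S (mat_modulus S_out)
    \<and> interval_mat S (mat_modulus S_out)
        \<subseteq> interval_mat S_num (mat_modulus S_out + mat_modulus (S_num - S))"
proof -
  let ?M = "\<lambda>I k. moment_mat n N t \<gamma> \<rho> lam X I k"
  have carrier: "?M I k * B * V \<in> carrier_mat n l" for I k
    using moment_mat_carrier[OF X(1)] B(1) V by (intro mult_carrier_mat)
  have "?M {0..<r} k * B * V = ?M {0..<t} k * B * V + ?M {t..<r} k * B * V" for k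
  proof -
    have "?M {0..<r} k = ?M {0..<t} k + ?M {t..<r} k"
      using moment_mat_Un_disjoint[OF X(1), of "{0..<t}" "{t..<r}"] t
      by (simp add: ivl_disj_un ivl_disj_int)
    also have "\<dots> * B * V = (?M {0..<t} k * B + ?M {t..<r} k * B) * V"
      using add_mult_distrib_mat[OF moment_mat_carrier[OF X(1)] moment_mat_carrier[OF X(1)] B(1)]
      by simp
    also have "\<dots> = ?M {0..<t} k * B * V + ?M {t..<r} k * B * V"
      using moment_mat_carrier[OF X(1)] B(1) V
      by (intro add_mult_distrib_mat mult_carrier_mat)
    finally show ?thesis .
  qed
  then have split: "S = S_in + S_out"
    unfolding S S_in S_out using block_row_add[OF carrier carrier] by simp
  have in_out: "S_in \<in> carrier_mat n (l * m)" "S_out \<in> carrier_mat n (l * m)"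
    unfolding S_in S_out by (intro block_row_carrier carrier)+
  then have "S \<in> carrier_mat n (l * m)"
    unfolding split by simp
  then show ?thesis
    using summand_in_interval_mat[OF in_out] interval_mat_recenter[OF _ S_num] split by simp
qed

end
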